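(* Consider a distributed storage system (DSS) that uses an $[n,k]$ Reed-Solomon (RS) code $\mathscr{C}$ over $\mathbb{F}_q$ to store $f$ messages over $n$ noncolluding databases using Lagrange encoding. Let $\mu\in\{f,f+1,\ldots,\mu_g(f)\}$ be the number of candidate polynomial function evaluations of degree at most $g$, including the $f$ independent messages. Then the private polynomial computation (PPC) rate $$\mathsf{R}_{\mathrm{PPC},\infty}=\frac{k}{n}\left(\frac{\max\{n-g(k-1)-1,0\}}{g(k-1)+1}\right)\mathsf{H}_{\min}$$ is achievable as $f\to\infty$; that is, with $n,k,g,q$ fixed and for any choice of candidate sets for each $f$, there are PPC protocols with rates $\mathsf{R}_f=\left(\frac{k}{n}\cdot\frac{\max\{n-g(k-1)-1,0\}}{g(k-1)+1}+\varepsilon_f\right)\mathsf{H}_{\min}$, where $\varepsilon_f\to0$ as $f\to\infty$ (and $\mathsf{H}_{\min}$ is that of the candidate set for $f$).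
   Context: Notation: $[a]=\{1,\ldots,a\}$; entropies $H$ are in $q$-ary units. $\mathsf{M}_g(f)=\binom{g+f}{g}-1$ is the number of monomials in $f$ variables of degree between $1$ and $g$, and $\mu_g(f)=\frac{q^{\mathsf{M}_g(f)}-1}{q-1}$ is the number of polynomials that are linear combinations over $\mathbb{F}_q$ of these monomials with nonzero coefficient vectors, counted up to scalar multiples. Lagrange encoding: let $\alpha_1,\ldots,\alpha_n\in\mathbb{F}_q$ be distinct and $\gamma_1,\ldots,\gamma_k\in\mathbb{F}_q$ be distinct ($q\ge n\ge k$). The $[n,k]$ RS code is $\{(\phi(\alpha_1),\ldots,\phi(\alpha_n)):\phi\in\mathbb{F}_q[z],\deg\phi<k\}$; a vector $(w_1,\ldots,w_k)\in\mathbb{F}_q^k$ is encoded as $(\ell(\alpha_1),\ldots,\ell(\alpha_n))$, where $\ell$ is the unique polynomial of degree at most $k-1$ with $\ell(\gamma_i)=w_i$ for all $i\in[k]$. Storage: there are $f$ independent messages $\mathbf{W}^{(1)},\ldots,\mathbf{W}^{(f)}$; each $\mathbf{W}^{(m)}$ is a random $\beta\times k$ matrix with entries i.i.d. uniform over $\mathbb{F}_q$, also written as a vector $(W^{(m)}_1,\ldots,W^{(m)}_{\mathsf{L}})$ with $\mathsf{L}=\beta k$. Each row $\mathbf{W}^{(m)}_i$ is Lagrange-encoded into $(C^{(m)}_{i,1},\ldots,C^{(m)}_{i,n})$. Database $j\in[n]$ stores $\mathbf{C}_j=(C^{(m)}_{i,j})_{i\in[\beta],m\in[f]}$. The parameter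 $\beta$ may be chosen by the scheme. Candidate functions: $\phi^{(1)},\ldots,\phi^{(\mu)}$ are polynomials in $f$ variables over $\mathbb{F}_q$ that are linear combinations of monomials of degree between $1$ and $g$ with pairwise nonproportional nonzero coefficient vectors, and the coordinate polynomials $z_1,\ldots,z_f$ (the $f$ messages) are among them. Put $X^{(v)}_l=\phi^{(v)}(W^{(1)}_l,\ldots,W^{(f)}_l)$ for $l\in[\mathsf{L}]$, $\mathbf{X}^{(v)}=(X^{(v)}_1,\ldots,X^{(v)}_{\mathsf{L}})$, $\mathbf{X}^{[\mu]}=(\mathbf{X}^{(1)},\ldots,\mathbf{X}^{(\mu)})$, and $\mathsf{H}_{\min}=\min_{v\in[\mu]}H(X^{(v)}_l)$ (independent of $l$). PPC protocol: for each desired index $v\in[\mu]$ the user sends a (random) query $Q^{(v)}_j$, generated independently of the messages, to each database $j\in[n]$. Database $j$ returns an answer $A^{(v)}_j$ (a string of symbols of $\mathbb{F}_q$) that is a deterministic function of $Q^{(v)}_j$ and $\mathbf{C}_j$. The protocol must satisfy, for all $v\ne v'$ in $[\mu]$ and $j\in[n]$: (privacy) $(Q^{(v)}_j,A^{(v)}_j,\mathbf{X}^{[\mu]})$ and $(Q^{(v')}_j,A^{(v')}_j,\mathbf{X}^{[\mu]})$ are identically distributed; (recovery) $H(\mathbf{X}^{(v)}\mid A^{(v)}_1,\ldots,A^{(v)}_n,Q^{(v)}_1,\ldots,Q^{(v)}_n)=0$. Rate: the rate of a protocol is $\mathsf{L}\mathsf{H}_{\min}/\mathsf{D}$, where $\mathsf{D}$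 is the total download cost, i.e. the total number of symbols of $\mathbb{F}_q$ downloaded from all databases. A rate is achievable if there is a PPC protocol attaining it for some $\beta$. *)

theory Defs
  imports
    "HOL-Probability.Probability"
    "HOL-Library.Poly_Mapping"
    "HOL-Computational_Algebra.Polynomial"
begin

text \<open>
  The field with \<open>q\<close> elements is a type \<open>'a :: {finite, field}\<close> with \<open>q = CARD('a)\<close>. All index
  sets \<open>[a] = {1, ..., a}\<close> are shifted to \<open>{..<a}\<close>.
\<close>

section \<open>Candidate polynomials\<close>

text \<open>
  A multivariate polynomial maps exponent vectors to coefficients. These are formal polynomials:
  over a finite field different ones may induce the same function.
\<close>

type_synonym 'a mpoly = "(nat \<Rightarrow>\<^sub>0 nat) \<Rightarrow>\<^sub>0 'a"

definition mono_degree :: "(nat \<Rightarrow>\<^sub>0 nat) \<Rightarrow> nat" where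
  "mono_degree m = (\<Sum>i\<in>Poly_Mapping.keys m. Poly_Mapping.lookup m i)"

definition mpoly_eval :: "'a::comm_ring_1 mpoly \<Rightarrow> (nat \<Rightarrow> 'a) \<Rightarrow> 'a" where
  "mpoly_eval p x = (\<Sum>m\<in>Poly_Mapping.keys p. Poly_Mapping.lookup p m * (\<Prod>i\<in>Poly_Mapping.keys m. x i ^ Poly_Mapping.lookup m i))"

definition mpoly_var :: "nat \<Rightarrow> 'a::comm_ring_1 mpoly" where
  "mpoly_var i = Poly_Mapping.single (Poly_Mapping.single i 1) 1"

definition proportional :: "'a::field mpoly \<Rightarrow> 'a mpoly \<Rightarrow> bool" where
  "proportional p p' \<longleftrightarrow> (\<exists>c. c \<noteq> 0 \<and> (\<forall>m. Poly_Mapping.lookup p' m = c * Poly_Mapping.lookup p m))"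

definition candidate_set :: "nat \<Rightarrow> nat \<Rightarrow> nat \<Rightarrow> (nat \<Rightarrow> 'a::field mpoly) \<Rightarrow> bool" where
  "candidate_set g f \<mu> \<phi> \<longleftrightarrow>
     (\<forall>v<\<mu>. \<phi> v \<noteq> 0 \<and>
        (\<forall>m\<in>Poly_Mapping.keys (\<phi> v). Poly_Mapping.keys m \<subseteq> {..<f} \<and> 1 \<le> mono_degree m \<and> mono_degree m \<le> g)) \<and>
     (\<forall>v<\<mu>. \<forall>v'<\<mu>. v \<noteq> v' \<longrightarrow> \<not> proportional (\<phi> v) (\<phi> v')) \<and>
     (\<forall>m<f. \<exists>v<\<mu>. \<phi> v = mpoly_var m)"

definition num_monomials :: "nat \<Rightarrow> nat \<Rightarrow> nat" where
  "num_monomials g f = ((g + f) choose g) - 1"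

definition num_candidates :: "nat \<Rightarrow> nat \<Rightarrow> nat \<Rightarrow> nat" where
  "num_candidates q g f = (q ^ num_monomials g f - 1) div (q - 1)"

section \<open>Reed-Solomon coded storage with Lagrange encoding\<close>

definition rs_code :: "nat \<Rightarrow> nat \<Rightarrow> (nat \<Rightarrow> 'a::field) \<Rightarrow> 'a list set" where
  "rs_code n k \<alpha> = {map (\<lambda>j. poly p (\<alpha> j)) [0..<n] |p. degree p < k}"

definition lagrange_poly :: "nat \<Rightarrow> (nat \<Rightarrow> 'a::field) \<Rightarrow> (nat \<Rightarrow> 'a) \<Rightarrow> 'a poly" where
  "lagrange_poly k \<gamma> w = (THE p. degree p < k \<and> (\<forall>c<k. poly p (\<gamma> c) = w c))"

definition lagrange_encode ::
    "nat \<Rightarrow> nat \<Rightarrow> (nat \<Rightarrow> 'a::field) \<Rightarrow> (nat \<Rightarrow> 'a) \<Rightarrow> (nat \<Rightarrow> 'a) \<Rightarrow> 'a list" where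
  "lagrange_encode n k \<alpha> \<gamma> w = map (\<lambda>j. poly (lagrange_poly k \<gamma> w) (\<alpha> j)) [0..<n]"

lemma ex1_lagrange_poly:
  fixes \<gamma> w :: "nat \<Rightarrow> 'a::field"
  assumes "1 \<le> k" and inj: "inj_on \<gamma> {..<k}"
  shows "\<exists>!p. degree p < k \<and> (\<forall>c<k. poly p (\<gamma> c) = w c)"
proof (rule ex_ex1I)
  define L where "L c = (\<Prod>d\<in>{..<k} - {c}. [:- \<gamma> d, 1:])" for c
  define p where "p = (\<Sum>c<k. smult (w c / poly (L c) (\<gamma> c)) (L c))"
  have deg: "degree (L c) < k" if "c < k" for c
  proof -
    have "degree (L c) \<le> (\<Sum>d\<in>{..<k} - {c}. degree [:- \<gamma> d, 1:])"
      unfolding L_def by (rule order_trans[OF degree_prod_sum_le]) simp_all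
    also have "\<dots> = k - 1" using that by simp
    finally show ?thesis using \<open>1 \<le> k\<close> by linarith
  qed
  have nz: "poly (L c) (\<gamma> c) \<noteq> 0" if "c < k" for c
    using inj that by (auto simp: L_def poly_prod inj_on_def)
  have z: "poly (L d) (\<gamma> c) = 0" if "c < k" "d \<noteq> c" for c d
    using that by (auto simp: L_def poly_prod)
  have "degree p < k"
    unfolding p_def using \<open>1 \<le> k\<close> deg
    by (intro degree_sum_less) (auto intro: le_less_trans[OF degree_smult_le])
  moreover have "poly p (\<gamma> c) = w c" if "c < k" for c
  proof -
    have "poly p (\<gamma> c) = (\<Sum>d<k. if d = c then w c else 0)"
      unfolding p_def poly_sum using nz z that by (intro sum.cong) auto
    then show ?thesis using that by simp
  qed
  ultimately show "\<exists>p. degree p < k \<and> (\<forall>c<k. poly p (\<gamma> c) = w c)" by blast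
next
  fix p p' assume "degree p < k \<and> (\<forall>c<k. poly p (\<gamma> c) = w c)"
    and "degree p' < k \<and> (\<forall>c<k. poly p' (\<gamma> c) = w c)"
  then show "p = p'"
    using inj by (intro poly_eqI_degree[of "\<gamma> ` {..<k}"]) (auto simp: card_image)
qed

lemma range_lagrange_encode:
  fixes \<alpha> \<gamma> :: "nat \<Rightarrow> 'a::field"
  assumes "1 \<le> k" and "inj_on \<gamma> {..<k}"
  shows "range (lagrange_encode n k \<alpha> \<gamma>) = rs_code n k \<alpha>"
proof -
  have deg: "degree (lagrange_poly k \<gamma> w) < k" for w
    using theI'[OF ex1_lagrange_poly[OF assms, of w]] by (simp add: lagrange_poly_def)
  have eq: "lagrange_poly k \<gamma> (\<lambda>c. poly p (\<gamma> c)) = p" if "degree p < k" for p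
    unfolding lagrange_poly_def
    by (rule the1_equality[OF ex1_lagrange_poly[OF assms]]) (use that in simp)
  show ?thesis
  proof (intro equalityI subsetI)
    fix x assume "x \<in> range (lagrange_encode n k \<alpha> \<gamma>)"
    then show "x \<in> rs_code n k \<alpha>"
      using deg by (auto simp: rs_code_def lagrange_encode_def)
  next
    fix x assume "x \<in> rs_code n k \<alpha>"
    then obtain p where p: "degree p < k" "x = map (\<lambda>j. poly p (\<alpha> j)) [0..<n]"
      by (auto simp: rs_code_def)
    then have "x = lagrange_encode n k \<alpha> \<gamma> (\<lambda>c. poly p (\<gamma> c))"
      by (simp add: lagrange_encode_def eq)
    then show "x \<in> range (lagrange_encode n k \<alpha> \<gamma>)" by blast
  qed
qed

text \<open>
  A realization \<open>W\<close> of all messages assigns to \<open>(m, i, c)\<close> the entry of the \<open>m\<close>-th message matrix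
  in row \<open>i\<close> and column \<open>c\<close>. Read as a vector (row by row), its \<open>l\<close>-th symbol is the entry
  \<open>(l div k, l mod k)\<close>.
\<close>

type_synonym 'a messages = "nat \<times> nat \<times> nat \<Rightarrow> 'a"

definition messages_pmf :: "nat \<Rightarrow> nat \<Rightarrow> nat \<Rightarrow> 'a::{finite,field} messages pmf" where
  "messages_pmf k f \<beta> = Pi_pmf ({..<f} \<times> {..<\<beta>} \<times> {..<k}) 0 (\<lambda>_. pmf_of_set UNIV)"

definition message_symbol :: "nat \<Rightarrow> 'a messages \<Rightarrow> nat \<Rightarrow> nat \<Rightarrow> 'a" where
  "message_symbol k W l m = W (m, l div k, l mod k)"

text \<open>The content of database \<open>j\<close> is a \<open>\<beta> \<times> f\<close> array.\<close>

definition stored ::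
    "nat \<Rightarrow> nat \<Rightarrow> (nat \<Rightarrow> 'a::field) \<Rightarrow> (nat \<Rightarrow> 'a) \<Rightarrow> nat \<Rightarrow> nat \<Rightarrow> 'a messages \<Rightarrow> nat
      \<Rightarrow> 'a list list" where
  "stored n k \<alpha> \<gamma> f \<beta> W j =
     map (\<lambda>i. map (\<lambda>m. lagrange_encode n k \<alpha> \<gamma> (\<lambda>c. W (m, i, c)) ! j) [0..<f]) [0..<\<beta>]"

definition func_vec :: "nat \<Rightarrow> nat \<Rightarrow> 'a::field mpoly \<Rightarrow> 'a messages \<Rightarrow> 'a list" where
  "func_vec k \<beta> p W = map (\<lambda>l. mpoly_eval p (message_symbol k W l)) [0..<\<beta> * k]"

text \<open>
  For each fixed \<open>l\<close> the \<open>f\<close> symbols at position \<open>l\<close> of the messages are i.i.d. uniform, so the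
  entropy of one symbol of a function evaluation depends neither on \<open>l\<close> nor on \<open>\<beta>\<close>. It is defined
  below from this common distribution.
\<close>

definition symbols_pmf :: "nat \<Rightarrow> (nat \<Rightarrow> 'a::{finite,field}) pmf" where
  "symbols_pmf f = Pi_pmf {..<f} 0 (\<lambda>_. pmf_of_set UNIV)"

lemma map_message_symbol:
  assumes "l < \<beta> * k"
  shows "map_pmf (\<lambda>W. message_symbol k W l) (messages_pmf k f \<beta>) =
         (symbols_pmf f :: (nat \<Rightarrow> 'a::{finite,field}) pmf)"
proof -
  define h where "h m = (m, l div k, l mod k)" for m :: nat
  define I where "I = {..<f} \<times> {..<\<beta>} \<times> {..<k}"
  have lk: "l div k < \<beta>" "l mod k < k"
    using assms by (auto simp: less_mult_imp_div_less intro!: mod_less_divisor gr0I)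
  have sub: "h ` {..<f} \<subseteq> I" using lk by (auto simp: h_def I_def)
  have fin: "finite I" by (simp add: I_def)
  let ?u = "pmf_of_set (UNIV :: 'a set)"
  have inI: "h m \<in> I \<longleftrightarrow> m < f" for m using lk by (auto simp: h_def I_def)
  have "(symbols_pmf f :: (nat \<Rightarrow> 'a) pmf) = map_pmf (\<lambda>W. W \<circ> h) (Pi_pmf (h ` {..<f}) 0 (\<lambda>_. ?u))"
    unfolding symbols_pmf_def
    by (rule Pi_pmf_bij_betw) (auto simp: bij_betw_def inj_on_def h_def)
  also have "\<dots> = map_pmf (\<lambda>W m. if m < f then W (h m) else 0) (Pi_pmf I 0 (\<lambda>_. ?u))"
    unfolding Pi_pmf_subset[OF fin sub] map_pmf_comp
    by (intro map_pmf_cong) (auto simp: fun_eq_iff h_def)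
  also have "\<dots> = map_pmf (\<lambda>W. message_symbol k W l) (Pi_pmf I 0 (\<lambda>_. ?u))"
    using set_Pi_pmf_subset[OF fin, of 0 "\<lambda>_. ?u"] inI
    by (intro map_pmf_cong) (auto simp: fun_eq_iff message_symbol_def h_def)
  finally show ?thesis by (simp add: messages_pmf_def I_def)
qed

definition func_entropy :: "nat \<Rightarrow> 'a::{finite,field} mpoly \<Rightarrow> real" where
  "func_entropy f p =
     prob_space.entropy (measure_pmf (symbols_pmf f)) (real CARD('a)) (count_space UNIV)
       (mpoly_eval p)"

definition H_min :: "nat \<Rightarrow> nat \<Rightarrow> (nat \<Rightarrow> 'a::{finite,field} mpoly) \<Rightarrow> real" where
  "H_min f \<mu> \<phi> = Min ((\<lambda>v. func_entropy f (\<phi> v)) ` {..<\<mu>})"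

section \<open>Private polynomial computation\<close>

text \<open>
  A scheme consists of the number \<open>\<beta>\<close> of rows, for each desired index \<open>v\<close> the joint distribution
  \<open>Q v\<close> of the \<open>n\<close> queries, and the answer functions of the databases. The answer function of
  database \<open>j\<close> sees neither \<open>v\<close> nor the queries to the other databases. Queries are discrete and
  coded as natural numbers.
\<close>

definition sample_pmf ::
    "nat \<Rightarrow> nat \<Rightarrow> nat \<Rightarrow> (nat \<Rightarrow> nat list pmf) \<Rightarrow> nat
      \<Rightarrow> ('a::{finite,field} messages \<times> nat list) pmf" where
  "sample_pmf k f \<beta> Q v = pair_pmf (messages_pmf k f \<beta>) (Q v)"

definition answers ::
    "nat \<Rightarrow> nat \<Rightarrow> (nat \<Rightarrow> 'a::field) \<Rightarrow> (nat \<Rightarrow> 'a) \<Rightarrow> nat \<Rightarrow> nat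
      \<Rightarrow> (nat \<Rightarrow> nat \<Rightarrow> 'a list list \<Rightarrow> 'a list) \<Rightarrow> 'a messages \<Rightarrow> nat list \<Rightarrow> 'a list list" where
  "answers n k \<alpha> \<gamma> f \<beta> ans W qs = map (\<lambda>j. ans j (qs ! j) (stored n k \<alpha> \<gamma> f \<beta> W j)) [0..<n]"

definition ppc_private ::
    "nat \<Rightarrow> nat \<Rightarrow> (nat \<Rightarrow> 'a::{finite,field}) \<Rightarrow> (nat \<Rightarrow> 'a) \<Rightarrow> nat \<Rightarrow> nat \<Rightarrow> (nat \<Rightarrow> 'a mpoly)
      \<Rightarrow> nat \<Rightarrow> (nat \<Rightarrow> nat list pmf) \<Rightarrow> (nat \<Rightarrow> nat \<Rightarrow> 'a list list \<Rightarrow> 'a list) \<Rightarrow> bool" where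
  "ppc_private n k \<alpha> \<gamma> f \<mu> \<phi> \<beta> Q ans \<longleftrightarrow>
     (let view = (\<lambda>v j. map_pmf
            (\<lambda>(W, qs). (qs ! j, answers n k \<alpha> \<gamma> f \<beta> ans W qs ! j,
                        map (\<lambda>u. func_vec k \<beta> (\<phi> u) W) [0..<\<mu>]))
            (sample_pmf k f \<beta> Q v))
      in \<forall>v<\<mu>. \<forall>v'<\<mu>. v \<noteq> v' \<longrightarrow> (\<forall>j<n. view v j = view v' j))"

text \<open>
  All values range over countable types, so \<open>count_space UNIV\<close> is a \<open>\<sigma>\<close>-finite reference measure
  and this is the usual discrete conditional entropy.
\<close>

definition ppc_recovery ::
    "nat \<Rightarrow> nat \<Rightarrow> (nat \<Rightarrow> 'a::{finite,field}) \<Rightarrow> (nat \<Rightarrow> 'a) \<Rightarrow> nat \<Rightarrow> nat \<Rightarrow> (nat \<Rightarrow> 'a mpoly)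
      \<Rightarrow> nat \<Rightarrow> (nat \<Rightarrow> nat list pmf) \<Rightarrow> (nat \<Rightarrow> nat \<Rightarrow> 'a list list \<Rightarrow> 'a list) \<Rightarrow> bool" where
  "ppc_recovery n k \<alpha> \<gamma> f \<mu> \<phi> \<beta> Q ans \<longleftrightarrow>
     (\<forall>v<\<mu>. prob_space.conditional_entropy (measure_pmf (sample_pmf k f \<beta> Q v)) (real CARD('a))
         (count_space UNIV) (count_space UNIV)
         (\<lambda>(W, qs). func_vec k \<beta> (\<phi> v) W)
         (\<lambda>(W, qs). (answers n k \<alpha> \<gamma> f \<beta> ans W qs, qs)) = 0)"

definition ppc_protocol ::
    "nat \<Rightarrow> nat \<Rightarrow> (nat \<Rightarrow> 'a::{finite,field}) \<Rightarrow> (nat \<Rightarrow> 'a) \<Rightarrow> nat \<Rightarrow> nat \<Rightarrow> (nat \<Rightarrow> 'a mpoly)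
      \<Rightarrow> nat \<Rightarrow> (nat \<Rightarrow> nat list pmf) \<Rightarrow> (nat \<Rightarrow> nat \<Rightarrow> 'a list list \<Rightarrow> 'a list) \<Rightarrow> bool" where
  "ppc_protocol n k \<alpha> \<gamma> f \<mu> \<phi> \<beta> Q ans \<longleftrightarrow>
     1 \<le> \<beta> \<and> (\<forall>v<\<mu>. \<forall>qs\<in>set_pmf (Q v). length qs = n) \<and>
     ppc_private n k \<alpha> \<gamma> f \<mu> \<phi> \<beta> Q ans \<and> ppc_recovery n k \<alpha> \<gamma> f \<mu> \<phi> \<beta> Q ans"

text \<open>
  The download cost is a number attached to the protocol: every execution, whatever the desired
  index, the queries and the messages, downloads exactly \<open>D\<close> field symbols in total.
\<close>

definition download_cost ::
    "nat \<Rightarrow> nat \<Rightarrow> (nat \<Rightarrow> 'a::{finite,field}) \<Rightarrow> (nat \<Rightarrow> 'a) \<Rightarrow> nat \<Rightarrow> nat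
      \<Rightarrow> nat \<Rightarrow> (nat \<Rightarrow> nat list pmf) \<Rightarrow> (nat \<Rightarrow> nat \<Rightarrow> 'a list list \<Rightarrow> 'a list) \<Rightarrow> nat \<Rightarrow> bool" where
  "download_cost n k \<alpha> \<gamma> f \<mu> \<beta> Q ans D \<longleftrightarrow>
     (\<forall>v<\<mu>. \<forall>(W, qs)\<in>set_pmf (sample_pmf k f \<beta> Q v).
        (\<Sum>A\<leftarrow>answers n k \<alpha> \<gamma> f \<beta> ans W qs. length A) = D)"

definition ppc_achievable ::
    "nat \<Rightarrow> nat \<Rightarrow> (nat \<Rightarrow> 'a::{finite,field}) \<Rightarrow> (nat \<Rightarrow> 'a) \<Rightarrow> nat \<Rightarrow> nat \<Rightarrow> (nat \<Rightarrow> 'a mpoly)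
      \<Rightarrow> real \<Rightarrow> bool" where
  "ppc_achievable n k \<alpha> \<gamma> f \<mu> \<phi> R \<longleftrightarrow>
     (\<exists>\<beta> Q ans D. ppc_protocol n k \<alpha> \<gamma> f \<mu> \<phi> \<beta> Q ans \<and>
        download_cost n k \<alpha> \<gamma> f \<mu> \<beta> Q ans D \<and> 0 < D \<and>
        R = real (\<beta> * k) * H_min f \<mu> \<phi> / real D)"

end

theory Submission
  imports Defs
begin

text \<open>
  Put \<open>K = g (k - 1) + 1\<close>. Applying a candidate polynomial to the coded symbols of one row gives a
  word of the \<open>[n, K]\<close> Reed-Solomon code, so the databases virtually hold \<open>\<mu>\<close> files coded with this
  MDS code. If \<open>n > K\<close>, star-product private information retrieval applies. Use \<open>r = n - K\<close> rows
  and \<open>K\<close> rounds; in round \<open>s\<close> every database returns one random linear combination, the same for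
  all databases, of the \<open>r \<mu>\<close> words, and database \<open>s + i\<close> moreover adds its symbol of row \<open>i\<close> of the
  desired word (\<open>i < r\<close>). The other \<open>K\<close> databases reveal the random codeword, so the \<open>r\<close> added
  symbols can be isolated; over the \<open>K\<close> rounds each desired row is seen at \<open>K\<close> positions and can be
  interpolated. A single query is uniform whatever is desired. This gives rate
  \<open>r k / (n K) \<cdot> H\<^sub>m\<^sub>i\<^sub>n\<close> exactly. If \<open>n \<le> K\<close>, downloading everything has
  rate \<open>k / (n f) \<cdot> H\<^sub>m\<^sub>i\<^sub>n\<close>, and the factor \<open>k / (n f)\<close> tends to \<open>0\<close>.
\<close>

section \<open>Conditional entropy of a determined variable\<close>

text \<open>If \<open>Y\<close> determines \<open>X\<close> on the support, the joint mass at
  \<open>(x, y)\<close> is either 0 or equal to the mass of \<open>y\<close>, so every term of the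
  entropy sum vanishes. Countability makes the product of the counting measures a counting measure
  again, and each of them sigma-finite.\<close>

lemma conditional_entropy_eq_0:
  fixes p :: "'b pmf" and X :: "'b \<Rightarrow> 'c::countable" and Y :: "'b \<Rightarrow> 'd::countable"
  assumes b: "1 < b"
    and det: "\<And>\<omega> \<omega>'. \<omega> \<in> set_pmf p \<Longrightarrow> \<omega>' \<in> set_pmf p \<Longrightarrow> Y \<omega> = Y \<omega>' \<Longrightarrow> X \<omega> = X \<omega>'"
  shows "prob_space.conditional_entropy (measure_pmf p) b (count_space UNIV) (count_space UNIV) X Y = 0"
proof -
  interpret information_space "measure_pmf p" b
    by unfold_locales (rule b)
  let ?Pxy = "pmf (map_pmf (\<lambda>\<omega>. (X \<omega>, Y \<omega>)) p)" and ?Py = "pmf (map_pmf Y p)"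
  have prod: "count_space (UNIV :: 'c set) \<Otimes>\<^sub>M count_space (UNIV :: 'd set) = count_space UNIV"
    by (simp add: pair_measure_countable)
  have dist: "distributed (measure_pmf p) (count_space UNIV) Z (pmf (map_pmf Z p))" for Z :: "'b \<Rightarrow> 'e"
    by (simp add: distributed_def map_pmf_rep_eq[symmetric] measure_pmf_eq_density[symmetric])
  have sf: "sigma_finite_measure (count_space (UNIV :: 'e::countable set))"
    by (rule sigma_finite_measure_count_space_countable) auto
  have "?Pxy (x, y) * log b (?Pxy (x, y) / ?Py y) = 0" for x y
  proof (cases "(x, y) \<in> set_pmf (map_pmf (\<lambda>\<omega>. (X \<omega>, Y \<omega>)) p)")
    case True
    then obtain \<omega> where \<omega>: "\<omega> \<in> set_pmf p" "x = X \<omega>" "y = Y \<omega>" by auto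
    have key: "X \<omega>' = x" if "\<omega>' \<in> set_pmf p" "Y \<omega>' = y" for \<omega>'
      using det[OF that(1) \<omega>(1)] that(2) \<omega>(2,3) by simp
    have "measure (measure_pmf p) ((\<lambda>\<omega>. (X \<omega>, Y \<omega>)) -` {(x, y)}) = measure (measure_pmf p) (Y -` {y})"
    proof (rule measure_pmf.finite_measure_eq_AE)
      show "AE \<omega>' in measure_pmf p. \<omega>' \<in> (\<lambda>\<omega>. (X \<omega>, Y \<omega>)) -` {(x, y)} \<longleftrightarrow> \<omega>' \<in> Y -` {y}"
        by (simp add: AE_measure_pmf_iff) (metis key)
    qed auto
    then have "?Pxy (x, y) = ?Py y" by (simp add: pmf_map)
    moreover have "?Py y > 0" using \<omega> by (auto simp: pmf_positive_iff)
    ultimately show ?thesis by simp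
  next
    case False
    then have "?Pxy (x, y) = 0" by (rule pmf_eq_0_set_pmf[THEN iffD2])
    then show ?thesis by simp
  qed
  then have "?Pxy z * log b (?Pxy z / ?Py (snd z)) = 0" for z
    by (metis prod.collapse)
  then show ?thesis
    unfolding conditional_entropy_generic_eq[OF sf sf dist[of Y] pmf_nonneg
        dist[of "\<lambda>\<omega>. (X \<omega>, Y \<omega>)", folded prod] pmf_nonneg]
    by (simp only: case_prod_unfold prod.collapse) simp
qed

section \<open>Candidate polynomials on codewords\<close>

text \<open>With \<open>h\<close> the Lagrange polynomials of one row, this single polynomial takes
  values computable by the databases at the \<alpha> points and the wanted function values at the
  \<gamma> points.\<close>

definition mpoly_subst :: "'a::comm_ring_1 mpoly \<Rightarrow> (nat \<Rightarrow> 'a poly) \<Rightarrow> 'a poly" where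
  "mpoly_subst p h = (\<Sum>m\<in>Poly_Mapping.keys p. smult (Poly_Mapping.lookup p m)
     (\<Prod>i\<in>Poly_Mapping.keys m. h i ^ Poly_Mapping.lookup m i))"

lemma poly_mpoly_subst: "poly (mpoly_subst p h) z = mpoly_eval p (\<lambda>i. poly (h i) z)"
  by (simp add: mpoly_subst_def mpoly_eval_def poly_sum poly_prod)

lemma degree_mpoly_subst_le:
  fixes h :: "nat \<Rightarrow> 'a::idom poly"
  assumes "\<And>m. m \<in> Poly_Mapping.keys p \<Longrightarrow> mono_degree m \<le> g"
    and h: "\<And>i. degree (h i) \<le> d"
  shows "degree (mpoly_subst p h) \<le> g * d"
  unfolding mpoly_subst_def
proof (rule degree_sum_le)
  fix m assume m: "m \<in> Poly_Mapping.keys p"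
  have "degree (\<Prod>i\<in>Poly_Mapping.keys m. h i ^ Poly_Mapping.lookup m i)
      \<le> (\<Sum>i\<in>Poly_Mapping.keys m. degree (h i ^ Poly_Mapping.lookup m i))"
    by (rule order_trans[OF degree_prod_sum_le]) simp_all
  also have "\<dots> \<le> (\<Sum>i\<in>Poly_Mapping.keys m. Poly_Mapping.lookup m i * d)"
    by (intro sum_mono order_trans[OF degree_power_le]) (simp add: h mult.commute)
  also have "\<dots> = mono_degree m * d" by (simp add: mono_degree_def sum_distrib_right)
  also have "\<dots> \<le> g * d" using assms(1)[OF m] by simp
  finally show "degree (smult (Poly_Mapping.lookup p m)
      (\<Prod>i\<in>Poly_Mapping.keys m. h i ^ Poly_Mapping.lookup m i)) \<le> g * d"
    by (rule order_trans[OF degree_smult_le])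
qed simp

text \<open>Needed because stored rows have only \<open>f\<close> entries: beyond index
  \<open>f\<close> nothing is known about list access, but candidates use only variables below
  \<open>f\<close>.\<close>

lemma mpoly_eval_cong:
  assumes "\<And>m. m \<in> Poly_Mapping.keys p \<Longrightarrow> Poly_Mapping.keys m \<subseteq> V"
    and "\<And>i. i \<in> V \<Longrightarrow> x i = y i"
  shows "mpoly_eval p x = mpoly_eval p y"
  unfolding mpoly_eval_def using assms
  by (intro sum.cong prod.cong arg_cong2[where f = "(*)"] refl) (metis subsetD)

lemma
  fixes \<gamma> w :: "nat \<Rightarrow> 'a::field"
  assumes "1 \<le> k" and "inj_on \<gamma> {..<k}"
  shows degree_lagrange_poly: "degree (lagrange_poly k \<gamma> w) < k"
    and poly_lagrange_poly: "c < k \<Longrightarrow> poly (lagrange_poly k \<gamma> w) (\<gamma> c) = w c"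
  using theI'[OF ex1_lagrange_poly[OF assms, of w]] by (simp_all add: lagrange_poly_def)

lemma stored_nth:
  assumes "j < n" and "i < \<beta>" and "m < f"
  shows "stored n k \<alpha> \<gamma> f \<beta> W j ! i ! m = poly (lagrange_poly k \<gamma> (\<lambda>c. W (m, i, c))) (\<alpha> j)"
  using assms by (simp add: stored_def lagrange_encode_def)

lemma poly_eqI_inj:
  fixes P P' :: "'a::field poly"
  assumes "inj_on \<alpha> J" and "degree P < card J" and "degree P' < card J"
    and "\<And>j. j \<in> J \<Longrightarrow> poly P (\<alpha> j) = poly P' (\<alpha> j)"
  shows "P = P'"
  by (rule poly_eqI_degree[of "\<alpha> ` J"]) (use assms in \<open>auto simp: card_image\<close>)

section \<open>Protocols\<close>

text \<open>Queries are independent of the messages, so the view of database \<open>j\<close>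
  depends on \<open>v\<close> only through the marginal law of its query. Recovery amounts to this:
  for fixed queries, equal answers force equal function values.\<close>

lemma ppc_protocolI:
  fixes \<alpha> \<gamma> :: "nat \<Rightarrow> 'a::{finite,field}" and \<phi> :: "nat \<Rightarrow> 'a mpoly"
  assumes "1 \<le> \<beta>"
    and len: "\<And>v qs. v < \<mu> \<Longrightarrow> qs \<in> set_pmf (Q v) \<Longrightarrow> length qs = n"
    and marginal: "\<And>v v' j. v < \<mu> \<Longrightarrow> v' < \<mu> \<Longrightarrow> j < n \<Longrightarrow>
      map_pmf (\<lambda>qs. qs ! j) (Q v) = map_pmf (\<lambda>qs. qs ! j) (Q v')"
    and decode: "\<And>v qs W W'. v < \<mu> \<Longrightarrow> qs \<in> set_pmf (Q v) \<Longrightarrow>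
      (\<And>j. j < n \<Longrightarrow> ans j (qs ! j) (stored n k \<alpha> \<gamma> f \<beta> W j) =
        ans j (qs ! j) (stored n k \<alpha> \<gamma> f \<beta> W' j)) \<Longrightarrow>
      func_vec k \<beta> (\<phi> v) W = func_vec k \<beta> (\<phi> v) W'"
  shows "ppc_protocol n k \<alpha> \<gamma> f \<mu> \<phi> \<beta> Q ans"
  unfolding ppc_protocol_def
proof (intro conjI)
  have view: "map_pmf (\<lambda>(W, qs). (qs ! j, answers n k \<alpha> \<gamma> f \<beta> ans W qs ! j, h W)) (sample_pmf k f \<beta> Q v) =
      map_pmf (\<lambda>(W, q). (q, ans j q (stored n k \<alpha> \<gamma> f \<beta> W j), h W))
        (pair_pmf (messages_pmf k f \<beta>) (map_pmf (\<lambda>qs. qs ! j) (Q v)))"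
    if "j < n" for v j and h :: "'a messages \<Rightarrow> 'a list list"
    using that unfolding pair_map_pmf2 map_pmf_comp sample_pmf_def
    by (intro map_pmf_cong) (auto simp: answers_def apsnd_def map_prod_def)
  show "ppc_private n k \<alpha> \<gamma> f \<mu> \<phi> \<beta> Q ans"
    unfolding ppc_private_def Let_def
  proof (intro allI impI, goal_cases)
    case (1 v v' j)
    then show ?case by (simp add: view marginal[of v v' j])
  qed
  have "CARD('a) > 1"
    using card_mono[of UNIV "{0, 1 :: 'a}"] by simp
  then show "ppc_recovery n k \<alpha> \<gamma> f \<mu> \<phi> \<beta> Q ans"
    unfolding ppc_recovery_def
  proof (intro allI impI conditional_entropy_eq_0)
    fix v and \<omega> \<omega>' :: "'a messages \<times> nat list"
    assume v: "v < \<mu>" and \<omega>: "\<omega> \<in> set_pmf (sample_pmf k f \<beta> Q v)"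
      and eq: "(case \<omega> of (W, qs) \<Rightarrow> (answers n k \<alpha> \<gamma> f \<beta> ans W qs, qs)) =
        (case \<omega>' of (W, qs) \<Rightarrow> (answers n k \<alpha> \<gamma> f \<beta> ans W qs, qs))"
    obtain W qs W' where [simp]: "\<omega> = (W, qs)" "\<omega>' = (W', qs)"
      using eq by (cases \<omega>; cases \<omega>') auto
    have "func_vec k \<beta> (\<phi> v) W = func_vec k \<beta> (\<phi> v) W'"
      using \<omega> eq by (intro decode[OF v]) (auto simp: sample_pmf_def answers_def)
    then show "(case \<omega> of (W, qs) \<Rightarrow> func_vec k \<beta> (\<phi> v) W) = (case \<omega>' of (W, qs) \<Rightarrow> func_vec k \<beta> (\<phi> v) W)"
      by simp
  qed simp
qed (use assms in auto)

lemma download_costI: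
  assumes "\<And>j q W. j < n \<Longrightarrow> length (ans j q (stored n k \<alpha> \<gamma> f \<beta> W j)) = d"
  shows "download_cost n k \<alpha> \<gamma> f \<mu> \<beta> Q ans (n * d)"
proof -
  have "(\<Sum>A\<leftarrow>answers n k \<alpha> \<gamma> f \<beta> ans W qs. length A) = n * d" for W qs
    using assms by (simp add: answers_def comp_def interv_sum_list_conv_sum_set_nat)
  then show ?thesis by (auto simp: download_cost_def)
qed

text \<open>A constant query makes privacy trivial. With one row, \<open>n * f\<close> symbols are
  downloaded for \<open>k\<close> function values.\<close>

lemma ppc_achievable_full_download:
  fixes \<alpha> \<gamma> :: "nat \<Rightarrow> 'a::{finite,field}"
  assumes k: "1 \<le> k" "k \<le> n" and inj: "inj_on \<alpha> {..<n}" "inj_on \<gamma> {..<k}"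
    and f: "1 \<le> f" and cand: "candidate_set g f \<mu> \<phi>"
  shows "ppc_achievable n k \<alpha> \<gamma> f \<mu> \<phi> (real k / (real n * real f) * H_min f \<mu> \<phi>)"
  unfolding ppc_achievable_def
proof (intro exI conjI)
  let ?Q = "\<lambda>_ :: nat. return_pmf (replicate n (0 :: nat))"
  let ?ans = "\<lambda>_ _ st. st ! 0 :: 'a list"
  show "ppc_protocol n k \<alpha> \<gamma> f \<mu> \<phi> 1 ?Q ?ans"
  proof (rule ppc_protocolI)
    fix v and qs :: "nat list" and W W' :: "'a messages"
    assume v: "v < \<mu>"
      and eq: "\<And>j. j < n \<Longrightarrow> stored n k \<alpha> \<gamma> f 1 W j ! 0 = stored n k \<alpha> \<gamma> f 1 W' j ! 0"
    let ?p = "\<lambda>W m. lagrange_poly k \<gamma> (\<lambda>c. W (m, 0, c))"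
    \<comment> \<open>Degree below \<open>k\<close> and \<open>n\<close> distinct points with
      \<open>k \<le> n\<close>: the answers fix each Lagrange polynomial, hence its values at the
      \<gamma> points.\<close>
    have p: "?p W m = ?p W' m" if "m < f" for m
    proof (rule poly_eqI_inj)
      show "poly (?p W m) (\<alpha> j) = poly (?p W' m) (\<alpha> j)" if "j \<in> {..<n}" for j
        using arg_cong[OF eq, of j "\<lambda>row. row ! m"] \<open>m < f\<close> that by (simp add: stored_nth)
    qed (use k inj in \<open>auto intro: less_le_trans[OF degree_lagrange_poly]\<close>)
    have W: "W (m, 0, c) = W' (m, 0, c)" if "m < f" "c < k" for m c
      using p[OF that(1)] poly_lagrange_poly[OF k(1) inj(2) that(2)] by metis
    have "mpoly_eval (\<phi> v) (message_symbol k W l) = mpoly_eval (\<phi> v) (message_symbol k W' l)"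
      if "l < k" for l
      using cand v W that
      by (intro mpoly_eval_cong[where V = "{..<f}"]) (auto simp: candidate_set_def message_symbol_def)
    then show "func_vec k 1 (\<phi> v) W = func_vec k 1 (\<phi> v) W'"
      by (simp add: func_vec_def)
  qed auto
  show "download_cost n k \<alpha> \<gamma> f \<mu> 1 ?Q ?ans (n * f)"
    by (rule download_costI) (simp add: stored_def)
qed (use k f in auto)

text \<open>Round \<open>s\<close> modifies the databases \<open>{s..<s + r}\<close>, and row
  \<open>i\<close> is seen at \<open>{i..<i + K}\<close>. As \<open>s < K\<close>,
  \<open>i < r\<close> and \<open>n = K + r\<close>, both windows fit into \<open>{..<n}\<close>
  without wrapping around.\<close>

lemma ppc_achievable_star_product:
  fixes \<alpha> \<gamma> :: "nat \<Rightarrow> 'a::{finite,field}"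
  assumes k: "1 \<le> k" and inj: "inj_on \<alpha> {..<n}" "inj_on \<gamma> {..<k}"
    and cand: "candidate_set g f \<mu> \<phi>"
    and K: "K = Suc (g * (k - 1))" and n: "n = K + r" and r: "1 \<le> r"
  shows "ppc_achievable n k \<alpha> \<gamma> f \<mu> \<phi> (real (r * k) * H_min f \<mu> \<phi> / real (n * K))"
proof -
  define F where "F W u i = mpoly_subst (\<phi> u) (\<lambda>m. lagrange_poly k \<gamma> (\<lambda>c. W (m, i, c)))"
    for W :: "'a messages" and u i
  have deg_F: "degree (F W u i) < K" if "u < \<mu>" for W u i
  proof -
    have "degree (F W u i) \<le> g * (k - 1)"
      unfolding F_def
    proof (rule degree_mpoly_subst_le)
      show "degree (lagrange_poly k \<gamma> w) \<le> k - 1" for w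
        using degree_lagrange_poly[OF k inj(2), of w] by simp
    qed (use cand that in \<open>auto simp: candidate_set_def\<close>)
    then show ?thesis by (simp add: K)
  qed
  have F_stored: "mpoly_eval (\<phi> u) (\<lambda>m. stored n k \<alpha> \<gamma> f r W j ! i ! m) = poly (F W u i) (\<alpha> j)"
    if "u < \<mu>" "i < r" "j < n" for W u i j
    unfolding F_def poly_mpoly_subst using cand that
    by (intro mpoly_eval_cong[where V = "{..<f}"]) (auto simp: candidate_set_def stored_nth)
  have F_message: "mpoly_eval (\<phi> u) (message_symbol k W l) = poly (F W u (l div k)) (\<gamma> (l mod k))"
    for W u l
    using k by (simp add: F_def poly_mpoly_subst message_symbol_def[abs_def] poly_lagrange_poly[OF k inj(2)])

  define I where "I = {..<K} \<times> {..<r} \<times> {..<\<mu>}"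
  \<comment> \<open>Coefficient tables indexed by round, row and candidate. Vanishing outside
    \<open>I\<close> makes the set finite, so that it carries a uniform law; it is still closed
    under addition.\<close>
  define \<Omega> where "\<Omega> = {U :: nat \<times> nat \<times> nat \<Rightarrow> 'a. \<forall>x. x \<notin> I \<longrightarrow> U x = 0}"
  have fin: "finite \<Omega>"
    using finite_set_of_finite_funs[of I "UNIV :: 'a set" 0] by (simp add: \<Omega>_def I_def)
  have \<Omega>_ne: "\<Omega> \<noteq> {}" unfolding \<Omega>_def by (auto intro!: exI[of _ "\<lambda>_. 0"])
  \<comment> \<open>Queries must be natural numbers, so tables are sent through an injective
    code.\<close>
  obtain enc :: "(nat \<times> nat \<times> nat \<Rightarrow> 'a) \<Rightarrow> nat" where enc: "inj_on enc \<Omega>"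
    using finite_imp_inj_to_nat_seg[OF fin] by blast
  define dec where "dec = inv_into \<Omega> enc"
  \<comment> \<open>The change to the shared table \<open>U\<close> that database \<open>j\<close>
    receives: in round \<open>s\<close> it affects at most the row \<open>i = j - s\<close>, and
    only for the desired candidate.\<close>
  define E where "E v j = (\<lambda>(s, i, u). if (s, i, u) \<in> I \<and> u = v \<and> s + i = j then 1 else 0 :: 'a)"
    for v j :: nat
  define query where "query v U j = enc (\<lambda>x. U x + E v j x)" for v U j
  define Q where "Q v = map_pmf (\<lambda>U. map (query v U) [0..<n]) (pmf_of_set \<Omega>)" for v
  define ans where "ans j q st = map (\<lambda>s. \<Sum>i<r. \<Sum>u<\<mu>.
      dec q (s, i, u) * mpoly_eval (\<phi> u) (\<lambda>m. st ! i ! m)) [0..<K]" for j q :: nat and st :: "'a list list"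
  have add_E: "(\<lambda>x. U x + E v j x) \<in> \<Omega>" if "U \<in> \<Omega>" for U v j
    using that by (auto simp: \<Omega>_def E_def)
  have dec_query: "dec (query v U j) = (\<lambda>x. U x + E v j x)" if "U \<in> \<Omega>" for U v j
    by (simp add: dec_def query_def inv_into_f_f[OF enc] add_E that)

  \<comment> \<open>The first summand is a word of the \<open>K\<close>-dimensional code shared by
    all databases; the second is at most one desired symbol.\<close>
  have ans_eq: "ans j (query v U j) (stored n k \<alpha> \<gamma> f r W j) ! s =
      poly (\<Sum>i<r. \<Sum>u<\<mu>. smult (U (s, i, u)) (F W u i)) (\<alpha> j) +
      (\<Sum>i<r. if s + i = j then poly (F W v i) (\<alpha> j) else 0)"
    if "v < \<mu>" "U \<in> \<Omega>" "j < n" "s < K" for v U W j s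
  proof -
    have E: "(\<Sum>u<\<mu>. E v j (s, i, u) * poly (F W u i) (\<alpha> j)) =
        (if s + i = j then poly (F W v i) (\<alpha> j) else 0)" if "i < r" for i
    proof -
      have "(\<Sum>u<\<mu>. E v j (s, i, u) * poly (F W u i) (\<alpha> j)) =
          (\<Sum>u<\<mu>. if u = v then if s + i = j then poly (F W v i) (\<alpha> j) else 0 else 0)"
        using that \<open>s < K\<close> by (intro sum.cong) (auto simp: E_def I_def)
      then show ?thesis using \<open>v < \<mu>\<close> by simp
    qed
    have "ans j (query v U j) (stored n k \<alpha> \<gamma> f r W j) ! s =
        (\<Sum>i<r. \<Sum>u<\<mu>. (U (s, i, u) + E v j (s, i, u)) * poly (F W u i) (\<alpha> j))"
      using that by (auto simp: ans_def dec_query F_stored intro!: sum.cong)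
    also have "\<dots> = (\<Sum>i<r. (\<Sum>u<\<mu>. U (s, i, u) * poly (F W u i) (\<alpha> j)) +
        (if s + i = j then poly (F W v i) (\<alpha> j) else 0))"
      by (intro sum.cong) (auto simp: distrib_right sum.distrib E)
    finally show ?thesis by (simp add: sum.distrib poly_sum)
  qed

  have "ppc_protocol n k \<alpha> \<gamma> f \<mu> \<phi> r Q ans"
  proof (rule ppc_protocolI)
    show "map_pmf (\<lambda>qs. qs ! j) (Q v) = map_pmf (\<lambda>qs. qs ! j) (Q v')" if "j < n" for v v' j
    proof -
      have "map_pmf (\<lambda>qs. qs ! j) (Q v) = map_pmf enc (pmf_of_set \<Omega>)" for v
      proof -
        \<comment> \<open>Translation permutes \<Omega>, so each single query is uniform whatever
          \<open>v\<close> is, although the queries to different databases are correlated through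
          \<open>U\<close>.\<close>
        have "bij_betw (\<lambda>U x. U x + E v j x) \<Omega> \<Omega>"
          by (rule bij_betw_byWitness[where f' = "\<lambda>U x. U x - E v j x"]) (auto simp: \<Omega>_def E_def)
        then have "map_pmf (\<lambda>U x. U x + E v j x) (pmf_of_set \<Omega>) = pmf_of_set \<Omega>"
          using \<Omega>_ne fin by (rule map_pmf_of_set_bij_betw)
        moreover have "map_pmf (\<lambda>qs. qs ! j) (Q v) = map_pmf enc (map_pmf (\<lambda>U x. U x + E v j x) (pmf_of_set \<Omega>))"
          using that by (simp add: Q_def query_def map_pmf_comp)
        ultimately show ?thesis by simp
      qed
      then show ?thesis by simp
    qed
  next
    fix v qs and W W' :: "'a messages"
    assume v: "v < \<mu>" and qs: "qs \<in> set_pmf (Q v)"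
      and same: "\<And>j. j < n \<Longrightarrow>
        ans j (qs ! j) (stored n k \<alpha> \<gamma> f r W j) = ans j (qs ! j) (stored n k \<alpha> \<gamma> f r W' j)"
    obtain U where U: "U \<in> \<Omega>" and "qs = map (query v U) [0..<n]"
      using qs fin \<Omega>_ne by (auto simp: Q_def)
    then have eq: "ans j (query v U j) (stored n k \<alpha> \<gamma> f r W j) =
        ans j (query v U j) (stored n k \<alpha> \<gamma> f r W' j)" if "j < n" for j
      using same[OF that] that by simp
    define \<rho> where "\<rho> W s = (\<Sum>i<r. \<Sum>u<\<mu>. smult (U (s, i, u)) (F W u i))" for W s
    have deg_\<rho>: "degree (\<rho> W s) < K" for W s
      unfolding \<rho>_def using deg_F K
      by (intro degree_sum_less) (auto intro: le_less_trans[OF degree_smult_le])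
    have eq': "poly (\<rho> W s) (\<alpha> j) + (\<Sum>i<r. if s + i = j then poly (F W v i) (\<alpha> j) else 0) =
        poly (\<rho> W' s) (\<alpha> j) + (\<Sum>i<r. if s + i = j then poly (F W' v i) (\<alpha> j) else 0)"
      if "j < n" "s < K" for j s
      using eq[of j] ans_eq[OF v U that] that by (metis \<rho>_def)
    have \<rho>: "\<rho> W s = \<rho> W' s" if "s < K" for s
    proof (rule poly_eqI_inj)
      \<comment> \<open>The databases with unmodified queries in round \<open>s\<close>: exactly
        \<open>K\<close> of them, enough to fix \<rho> of degree below \<open>K\<close>.\<close>
      let ?J = "{..<n} - {s..<s + r}"
      have "card ?J = K"
        using that n by (subst card_Diff_subset) auto
      then show "degree (\<rho> W s) < card ?J" "degree (\<rho> W' s) < card ?J" by (simp_all add: deg_\<rho>)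
      show "inj_on \<alpha> ?J" using inj(1) by (rule inj_on_subset) auto
      show "poly (\<rho> W s) (\<alpha> j) = poly (\<rho> W' s) (\<alpha> j)" if "j \<in> ?J" for j
      proof -
        have "s + i \<noteq> j" if "i < r" for i using \<open>j \<in> ?J\<close> that by auto
        then show ?thesis using eq'[of j s] \<open>j \<in> ?J\<close> \<open>s < K\<close> by simp
      qed
    qed
    have F_eq: "F W v i = F W' v i" if "i < r" for i
    proof (rule poly_eqI_inj)
      show "inj_on \<alpha> {i..<i + K}" using inj(1) by (rule inj_on_subset) (use that n in auto)
      show "poly (F W v i) (\<alpha> j) = poly (F W' v i) (\<alpha> j)" if j: "j \<in> {i..<i + K}" for j
      proof -
        \<comment> \<open>Database \<open>j\<close> contributes its symbol of row \<open>i\<close>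
          in round \<open>j - i\<close>, and no other row in that round.\<close>
        have "j - i < K" and "j - i + i' = j \<longleftrightarrow> i' = i" for i' using j by auto
        then show ?thesis
          using eq'[of j "j - i"] \<rho>[of "j - i"] j n \<open>i < r\<close> by simp
      qed
    qed (simp_all add: deg_F v)
    show "func_vec k r (\<phi> v) W = func_vec k r (\<phi> v) W'"
      by (auto simp: func_vec_def F_message F_eq less_mult_imp_div_less)
  qed (use r in \<open>auto simp: Q_def\<close>)
  moreover have "download_cost n k \<alpha> \<gamma> f \<mu> r Q ans (n * K)"
    by (rule download_costI) (simp add: ans_def)
  ultimately show ?thesis
    unfolding ppc_achievable_def using K n
    by (intro exI[of _ r] exI[of _ Q] exI[of _ ans] exI[of _ "n * K"]) auto
qed

section \<open>Rates for growing \<open>f\<close>\<close>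

theorem corollary1:
  fixes \<alpha> \<gamma> :: "nat \<Rightarrow> 'a::{finite,field}"
    and n k g :: nat
    and \<mu> :: "nat \<Rightarrow> nat"
    and \<phi> :: "nat \<Rightarrow> nat \<Rightarrow> 'a mpoly"
  assumes "1 \<le> k" and "k \<le> n" and "n \<le> CARD('a)" and "1 \<le> g"
    and "inj_on \<alpha> {..<n}" and "inj_on \<gamma> {..<k}"
    and "\<And>f. 1 \<le> f \<Longrightarrow> f \<le> \<mu> f \<and> \<mu> f \<le> num_candidates CARD('a) g f"
    and "\<And>f. 1 \<le> f \<Longrightarrow> candidate_set g f (\<mu> f) (\<phi> f)"
  shows "\<exists>\<epsilon> :: nat \<Rightarrow> real. \<epsilon> \<longlonglongrightarrow> 0 \<and>
    (\<forall>f\<ge>1. ppc_achievable n k \<alpha> \<gamma> f (\<mu> f) (\<phi> f)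
       ((real k / real n *
           (max (real n - real g * (real k - 1) - 1) 0 / (real g * (real k - 1) + 1)) + \<epsilon> f)
        * H_min f (\<mu> f) (\<phi> f)))"
proof -
  define K where "K = Suc (g * (k - 1))"
  have real_K: "real g * (real k - 1) + 1 = real K"
    using \<open>1 \<le> k\<close> by (simp add: K_def of_nat_diff)
  then have real_diff: "real n - real g * (real k - 1) - 1 = real n - real K" by simp
  show ?thesis
  proof (cases "n \<le> K")
    case True
    \<comment> \<open>The main term is 0 here, so the whole full-download factor serves as error
      term.\<close>
    have "(\<lambda>f. real k / (real n * real f)) \<longlonglongrightarrow> 0"
      using tendsto_mult_right_zero[OF lim_1_over_n, of "real k / real n"] by simp
    moreover have "max (real n - real K) 0 = 0" using True by simp
    ultimately show ?thesis
      unfolding real_K real_diff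
      using ppc_achievable_full_download[OF assms(1,2,5,6) _ assms(8)]
      by (intro exI[of _ "\<lambda>f. real k / (real n * real f)"]) simp
  next
    case False
    define r where "r = n - K"
    have r: "n = K + r" "1 \<le> r" using False by (simp_all add: r_def)
    \<comment> \<open>The factor \<open>r\<close> cancels nothing and equals the maximum, so the
      main term is attained exactly with zero error.\<close>
    have rate: "real k / real n * (max (real n - real K) 0 / real K) = real (r * k) / real (n * K)"
      using r by (simp add: mult.commute)
    have "ppc_achievable n k \<alpha> \<gamma> f (\<mu> f) (\<phi> f)
        ((real k / real n * (max (real n - real K) 0 / real K) + 0) * H_min f (\<mu> f) (\<phi> f))"
      if "1 \<le> f" for f
      using ppc_achievable_star_product[OF assms(1,5,6) assms(8)[OF that] K_def r] 
      unfolding rate by simp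
    then show ?thesis
      unfolding real_K real_diff by (intro exI[of _ "\<lambda>_. 0"]) simp
  qed
qed

end
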